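(* Let $1\leq p<\infty$ and let $P$ be a $1$-dispersed subset of $\ell_p$. Then $R(P)\geq 2^{-1/p}$.
   Context: $\ell_p$ is the space of real sequences $x=(x_i)_{i\in\mathbb{N}}$ with $\sum_{i=1}^\infty |x_i|^p<\infty$, with norm $\|x\|_p=\left(\sum_{i=1}^\infty |x_i|^p\right)^{1/p}$. $B(x,r)$ denotes the closed ball with center $x$ and radius $r$. A subset $P$ of a normed space $X$ is $\alpha$-dispersed if $\|x-y\|>\alpha$ (strict inequality) for all distinct $x,y\in P$. A subset $P\subseteq X$ is an $R$-covering if $X=\bigcup_{x\in P}B(x,R)$. For $P\subseteq X$ define $R(P):=\inf\{R : P \text{ is an } R\text{-covering}\}$ (with the infimum of the empty set equal to $+\infty$). *)

theory Defs
  imports Complex_Main "HOL-Library.Extended_Real"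
begin

definition lp_space :: "real \<Rightarrow> (nat \<Rightarrow> real) set" where
  "lp_space p = {x. summable (\<lambda>i. \<bar>x i\<bar> powr p)}"

definition lp_norm :: "real \<Rightarrow> (nat \<Rightarrow> real) \<Rightarrow> real" where
  "lp_norm p x = (\<Sum>i. \<bar>x i\<bar> powr p) powr (1 / p)"

text \<open>
  As \<open>p\<close> is a term parameter, the sequence space is not a type of its own. The notions for
  a normed space below therefore take its carrier \<open>X\<close> and its norm \<open>N\<close> as arguments; on
  sequences, \<open>x - y\<close> is the pointwise difference.
\<close>

definition closed_ball :: "'a::minus set \<Rightarrow> ('a \<Rightarrow> real) \<Rightarrow> 'a \<Rightarrow> real \<Rightarrow> 'a set" where
  "closed_ball X N x r = {y \<in> X. N (x - y) \<le> r}"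

definition dispersed :: "'a::minus set \<Rightarrow> ('a \<Rightarrow> real) \<Rightarrow> real \<Rightarrow> 'a set \<Rightarrow> bool" where
  "dispersed X N \<alpha> P \<longleftrightarrow> P \<subseteq> X \<and> (\<forall>x\<in>P. \<forall>y\<in>P. x \<noteq> y \<longrightarrow> N (x - y) > \<alpha>)"

definition is_covering :: "'a::minus set \<Rightarrow> ('a \<Rightarrow> real) \<Rightarrow> real \<Rightarrow> 'a set \<Rightarrow> bool" where
  "is_covering X N R P \<longleftrightarrow> P \<subseteq> X \<and> X = (\<Union>x\<in>P. closed_ball X N x R)"

text \<open>The infimum is taken in \<^typ>\<open>ereal\<close>, so it is \<open>\<infinity>\<close> if no real \<open>R\<close> qualifies.\<close>

definition covering_radius :: "'a::minus set \<Rightarrow> ('a \<Rightarrow> real) \<Rightarrow> 'a set \<Rightarrow> ereal" where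
  "covering_radius X N P = Inf {ereal R | R. is_covering X N R P}"

end

theory Submission
  imports Defs "HOL-Complex_Analysis.Great_Picard"
begin

text \<open>
  Two facts about \<open>\<ell>\<^sub>p\<close> are played against each other. Write \<open>s\<close> for \<open>2 powr (- (1 / p))\<close>.

  First, a \<open>1\<close>-dispersed set has only finitely many points in any ball of radius \<open>r < s\<close>
  (\<open>finite_dispersed_in_ball\<close>). Infinitely many points of the ball contain a sequence that
  converges in every coordinate. Up to a small error, two suitable members of it differ only by
  pieces with disjoint supports, each of norm at most \<open>r\<close>; so their distance is at
  most about \<open>r / s < 1\<close> (\<open>gliding_hump\<close>).

  Second, a covering by balls of radius \<open>R < s\<close> improves itself. Fix \<open>t > 0\<close> with \<open>R + t < s\<close> and
  a point \<open>x\<close>, and for every \<open>n\<close> shift the \<open>n\<close>-th coordinate of \<open>x\<close> by \<open>t\<close>. A point of \<open>P\<close> that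
  covers a shifted point lies within \<open>R + t\<close> of \<open>x\<close>, so only finitely many points of \<open>P\<close> occur, and one
  of them, \<open>c\<close>, covers the shifted point for infinitely many \<open>n\<close>. Since the coordinates of \<open>c - x\<close>
  tend to \<open>0\<close>, a shift far out adds almost exactly \<open>t powr p\<close> to the \<open>p\<close>-th power of the distance
  to \<open>c\<close>. So the \<open>p\<close>-th power of the distance from \<open>x\<close> to \<open>c\<close> is at most \<open>R powr p - t powr p\<close>
  (\<open>covering_improvement\<close>). The same \<open>t\<close> works again for the smaller radius, and
  after enough rounds the \<open>p\<close>-th power of a distance would be negative.
\<close>

section \<open>The p-th power of the norm\<close>

text \<open>
  The \<open>p\<close>-th power of the norm adds up over disjoint supports and changes in a controlled way
  when one coordinate is changed, so it is more convenient than the norm itself.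
\<close>

definition mass :: "real \<Rightarrow> (nat \<Rightarrow> real) \<Rightarrow> real" where
  "mass p x = (\<Sum>i. \<bar>x i\<bar> powr p)"

lemma mem_lp_space: "x \<in> lp_space p \<longleftrightarrow> summable (\<lambda>i. \<bar>x i\<bar> powr p)"
  by (simp add: lp_space_def)

lemma mass_nonneg: "x \<in> lp_space p \<Longrightarrow> 0 \<le> mass p x"
  unfolding mass_def mem_lp_space by (rule suminf_nonneg) auto

lemma lp_norm_eq_mass: "lp_norm p x = mass p x powr (1 / p)"
  by (simp add: lp_norm_def mass_def)

lemma lp_norm_le_iff_mass:
  assumes "1 \<le> p" "0 \<le> r" "x \<in> lp_space p"
  shows "lp_norm p x \<le> r \<longleftrightarrow> mass p x \<le> r powr p"
proof
  assume "lp_norm p x \<le> r"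
  then have "(mass p x powr (1 / p)) powr p \<le> r powr p"
    using assms by (intro powr_mono2) (auto simp: lp_norm_eq_mass)
  then show "mass p x \<le> r powr p"
    using assms mass_nonneg[OF assms(3)] by (simp add: powr_powr)
next
  assume "mass p x \<le> r powr p"
  then have "mass p x powr (1 / p) \<le> (r powr p) powr (1 / p)"
    using assms mass_nonneg[OF assms(3)] by (intro powr_mono2) auto
  then show "lp_norm p x \<le> r"
    using assms by (simp add: powr_powr lp_norm_eq_mass)
qed

section \<open>The triangle inequality\<close>

lemma convex_powr_nonneg:
  fixes p :: real
  assumes "1 \<le> p" shows "convex_on {0..} (\<lambda>x. x powr p)"
proof (rule convex_onI)
  fix s x y :: real
  assume s: "0 < s" "s < 1" and xy: "x \<in> {0..}" "y \<in> {0..}"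
  have shrink: "(l * z) powr p \<le> l * z powr p" if "0 < l" "l < 1" "0 \<le> z" for l z :: real
  proof -
    have "l powr p \<le> l powr 1"
      using that assms by (intro powr_mono') auto
    then show ?thesis using that by (simp add: powr_mult mult_right_mono)
  qed
  consider "x = 0" | "y = 0" | "0 < x" "0 < y" using xy by force
  then show "((1 - s) *\<^sub>R x + s *\<^sub>R y) powr p \<le> (1 - s) * x powr p + s * y powr p"
  proof cases
    case 3
    then show ?thesis
      using convex_onD[OF powr_convex[OF assms], of s x y] s by simp
  qed (use shrink[of s y] shrink[of "1 - s" x] s xy in auto)
qed simp

text \<open>
  Convexity of the power, applied to the average of \<open>\<bar>u\<bar> / a\<close> and \<open>\<bar>v\<bar> / b\<close> with weights
  \<open>a / (a + b)\<close> and \<open>b / (a + b)\<close>. These weights make the sum over all coordinates in the next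
  lemma collapse to \<open>(a + b) powr p\<close>.
\<close>

lemma powr_abs_add_le:
  fixes u v :: real
  assumes "1 \<le> p" "0 < a" "0 < b"
  shows "\<bar>u + v\<bar> powr p \<le> (a + b) powr p *
           (a / (a + b) * (\<bar>u\<bar> powr p / a powr p) + b / (a + b) * (\<bar>v\<bar> powr p / b powr p))"
proof -
  let ?s = "b / (a + b)"
  have s: "1 - ?s = a / (a + b)" "0 \<le> ?s" "?s \<le> 1" using assms by (auto simp: field_simps)
  have "\<bar>u + v\<bar> \<le> \<bar>u\<bar> + \<bar>v\<bar>" by simp
  also have "\<dots> = (a + b) * ((1 - ?s) * (\<bar>u\<bar> / a) + ?s * (\<bar>v\<bar> / b))"
  proof -
    have "a + b \<noteq> 0" using assms by simp
    then have "(a + b) * (a / (a + b) * (\<bar>u\<bar> / a)) = \<bar>u\<bar>" "(a + b) * (?s * (\<bar>v\<bar> / b)) = \<bar>v\<bar>"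
      using assms by simp_all
    then show ?thesis unfolding s(1) by (simp only: distrib_left)
  qed
  finally have "\<bar>u + v\<bar> powr p \<le> \<dots> powr p"
    using assms by (intro powr_mono2) auto
  also have "\<dots> = (a + b) powr p * ((1 - ?s) * (\<bar>u\<bar> / a) + ?s * (\<bar>v\<bar> / b)) powr p"
    using assms s by (intro powr_mult)
  also have "\<dots> \<le> (a + b) powr p *
      ((1 - ?s) * (\<bar>u\<bar> / a) powr p + ?s * (\<bar>v\<bar> / b) powr p)"
    using convex_onD[OF convex_powr_nonneg[OF assms(1)], of ?s "\<bar>u\<bar> / a" "\<bar>v\<bar> / b"] assms s
    by (intro mult_left_mono) auto
  finally show ?thesis using assms unfolding s(1) by (simp add: powr_divide)
qed

text \<open>
  Minkowski's inequality, stated with upper bounds \<open>a\<close> and \<open>b\<close> of the norms instead of the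
  norms: positive bounds can be chosen even for the zero sequence, so the division by \<open>a\<close> and
  \<open>b\<close> causes no degenerate cases.
\<close>

lemma minkowski_mass:
  assumes p: "1 \<le> p" and ab: "0 < a" "0 < b"
    and x: "x \<in> lp_space p" "mass p x \<le> a powr p"
    and y: "y \<in> lp_space p" "mass p y \<le> b powr p"
  shows "(\<lambda>i. x i + y i) \<in> lp_space p" "mass p (\<lambda>i. x i + y i) \<le> (a + b) powr p"
proof -
  let ?g = "\<lambda>i. (a + b) powr p *
    (a / (a + b) * (\<bar>x i\<bar> powr p / a powr p) + b / (a + b) * (\<bar>y i\<bar> powr p / b powr p))"
  have g: "?g sums ((a + b) powr p *
    (a / (a + b) * (mass p x / a powr p) + b / (a + b) * (mass p y / b powr p)))"
    using x(1) y(1) unfolding mass_def mem_lp_space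
    by (intro sums_mult sums_add sums_divide summable_sums)
  have le: "\<bar>x i + y i\<bar> powr p \<le> ?g i" for i
    by (rule powr_abs_add_le[OF p ab])
  show mem: "(\<lambda>i. x i + y i) \<in> lp_space p"
    unfolding mem_lp_space
    by (rule summable_comparison_test'[OF sums_summable[OF g], of 0]) (use le in auto)
  have "mass p (\<lambda>i. x i + y i) \<le> suminf ?g"
    unfolding mass_def
    using le mem sums_summable[OF g] by (intro suminf_le) (auto simp: mem_lp_space)
  also have "\<dots> = (a + b) powr p *
    (a / (a + b) * (mass p x / a powr p) + b / (a + b) * (mass p y / b powr p))"
    using g by (rule sums_unique[symmetric])
  also have "\<dots> \<le> (a + b) powr p * (a / (a + b) * 1 + b / (a + b) * 1)"
    using ab x(2) y(2) by (intro mult_left_mono add_mono) auto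
  also have "\<dots> = (a + b) powr p"
    using ab by (simp add: add_divide_distrib[symmetric])
  finally show "mass p (\<lambda>i. x i + y i) \<le> (a + b) powr p" .
qed

lemma lp_space_diff:
  assumes "1 \<le> p" "x \<in> lp_space p" "y \<in> lp_space p"
  shows "(\<lambda>i. x i - y i) \<in> lp_space p"
proof -
  have bound: "\<exists>a>0. mass p z \<le> a powr p" if "z \<in> lp_space p" for z
  proof (intro exI conjI)
    show "0 < mass p z powr (1 / p) + 1" by (simp add: add_nonneg_pos)
    have "mass p z = (mass p z powr (1 / p)) powr p"
      using assms(1) mass_nonneg[OF that] by (simp add: powr_powr)
    also have "\<dots> \<le> (mass p z powr (1 / p) + 1) powr p"
      using assms(1) by (intro powr_mono2) auto
    finally show "mass p z \<le> \<dots>" .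
  qed
  have ny: "(\<lambda>i. - y i) \<in> lp_space p" using assms(3) by (simp add: mem_lp_space)
  obtain a b where "0 < a" "mass p x \<le> a powr p" "0 < b" "mass p (\<lambda>i. - y i) \<le> b powr p"
    using bound[OF assms(2)] bound[OF ny] by blast
  from minkowski_mass(1)[OF assms(1) this(1,3) assms(2) this(2) ny this(4)]
  show ?thesis by simp
qed

section \<open>Coordinates and tails\<close>

lemma mass_fun_upd:
  assumes "y \<in> lp_space p"
  shows "y(n := w) \<in> lp_space p"
    and "mass p (y(n := w)) = mass p y - \<bar>y n\<bar> powr p + \<bar>w\<bar> powr p"
proof -
  have eq: "\<bar>(y(n := w)) i\<bar> powr p
      = \<bar>y i\<bar> powr p + (if i = n then \<bar>w\<bar> powr p - \<bar>y i\<bar> powr p else 0)" for i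
    by simp
  have "(\<lambda>i. \<bar>(y(n := w)) i\<bar> powr p) sums (mass p y + (\<bar>w\<bar> powr p - \<bar>y n\<bar> powr p))"
    unfolding eq mass_def using assms
    by (intro sums_add sums_single summable_sums) (simp add: mem_lp_space)
  then show "y(n := w) \<in> lp_space p"
    and "mass p (y(n := w)) = mass p y - \<bar>y n\<bar> powr p + \<bar>w\<bar> powr p"
    by (auto simp: mass_def mem_lp_space dest: sums_summable sums_unique)
qed

lemma lp_space_tendsto_zero:
  assumes "1 \<le> p" "y \<in> lp_space p"
  shows "y \<longlonglongrightarrow> 0"
proof -
  have "(\<lambda>i. (\<bar>y i\<bar> powr p) powr (1 / p)) \<longlonglongrightarrow> 0 powr (1 / p)"
    using assms by (intro tendsto_powr') (auto simp: mem_lp_space dest: summable_LIMSEQ_zero)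
  then show ?thesis
    using assms(1) by (simp add: powr_powr tendsto_rabs_zero_iff)
qed

lemma sum_powr_le_mass:
  assumes "x \<in> lp_space p" "finite A"
  shows "(\<Sum>i\<in>A. \<bar>x i\<bar> powr p) \<le> mass p x"
  using assms unfolding mass_def mem_lp_space by (intro sum_le_suminf) auto

lemma lp_small_tail:
  assumes "x \<in> lp_space p" "0 < \<delta>"
  obtains K where "\<And>L. L \<ge> K \<Longrightarrow> (\<Sum>i. \<bar>x (i + L)\<bar> powr p) < \<delta>"
proof -
  from suminf_exist_split[OF assms(2), of "\<lambda>i. \<bar>x i\<bar> powr p"] assms(1)
  obtain K where "\<And>n. n \<ge> K \<Longrightarrow> norm (\<Sum>i. \<bar>x (i + n)\<bar> powr p) < \<delta>"
    by (auto simp: mem_lp_space)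
  then show ?thesis by (intro that[of K]) fastforce
qed

section \<open>Dispersed sets in small balls\<close>

text \<open>
  Let \<open>v\<close> be the coordinatewise limit of a subsequence \<open>w\<close> of \<open>u\<close>; it lies in \<open>\<ell>\<^sub>p\<close> because the
  bound on the \<open>u n\<close> passes to partial sums of \<open>v\<close>. Choose in turn \<open>K\<close>, \<open>m\<close>, \<open>L\<close>, \<open>n\<close>: beyond \<open>K\<close>,
  \<open>v\<close> is small; below \<open>K\<close>, \<open>w m\<close> is close to \<open>v\<close>; beyond \<open>L\<close>, \<open>w m\<close> is small; below \<open>L\<close>, \<open>w n\<close> is
  close to \<open>v\<close>. Then below \<open>K\<close> the two nearly agree, between \<open>K\<close> and \<open>L\<close> only \<open>w m\<close> counts, and
  beyond \<open>L\<close> only \<open>w n\<close>. The two surviving pieces have disjoint supports, so their \<open>p\<close>-th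
  powers add up to at most \<open>2 * r powr p\<close>.
\<close>

lemma gliding_hump:
  fixes u :: "nat \<Rightarrow> nat \<Rightarrow> real"
  assumes p: "1 \<le> p" and r: "0 < r" and e: "0 < \<epsilon>"
    and mem: "\<And>n. u n \<in> lp_space p" and bd: "\<And>n. mass p (u n) \<le> r powr p"
  obtains m n where "m < n"
    "mass p (\<lambda>i. u m i - u n i) \<le> (2 powr (1 / p) * r + \<epsilon>) powr p"
proof -
  define \<delta> where "\<delta> = \<epsilon> powr p / 3"
  have \<delta>: "0 < \<delta>" using e by (simp add: \<delta>_def)
  have coord: "norm (u n i) \<le> r" for n i
  proof -
    have "\<bar>u n i\<bar> powr p \<le> r powr p"
      using sum_powr_le_mass[OF mem, of "{i}" n] bd[of n] by simp
    then have "\<not> r < \<bar>u n i\<bar>"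
      using powr_less_mono2[of p r "\<bar>u n i\<bar>"] p r by linarith
    then show ?thesis by simp
  qed
  obtain k where k: "strict_mono k" "\<And>i. \<exists>l. (\<lambda>n. u (k n) i) \<longlonglongrightarrow> l"
    using function_convergent_subsequence[of UNIV u r] coord by auto
  then obtain v where v: "\<And>i. (\<lambda>n. u (k n) i) \<longlonglongrightarrow> v i" by metis
  define w where "w n = u (k n)" for n
  have w: "w n \<in> lp_space p" "mass p (w n) \<le> r powr p" for n
    using mem bd by (simp_all add: w_def)
  have w_lim: "(\<lambda>n. w n i) \<longlonglongrightarrow> v i" for i using v by (simp add: w_def)
  have lim: "(\<lambda>n. \<Sum>i\<in>A. \<bar>w n i\<bar> powr p) \<longlonglongrightarrow> (\<Sum>i\<in>A. \<bar>v i\<bar> powr p)" for A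
    using p by (intro tendsto_sum tendsto_powr' tendsto_rabs w_lim) auto
  have vsum: "(\<Sum>i<N. \<bar>v i\<bar> powr p) \<le> r powr p" for N
  proof (rule LIMSEQ_le_const2[OF lim])
    have "(\<Sum>i<N. \<bar>w n i\<bar> powr p) \<le> r powr p" for n
      using sum_powr_le_mass[OF w(1)[of n], of "{..<N}"] w(2)[of n] by simp
    then show "\<exists>N0. \<forall>n\<ge>N0. (\<Sum>i<N. \<bar>w n i\<bar> powr p) \<le> r powr p" by blast
  qed
  have vmem: "v \<in> lp_space p"
    unfolding mem_lp_space by (rule summableI_nonneg_bounded[OF _ vsum]) simp
  obtain K where K: "(\<Sum>i. \<bar>v (i + K)\<bar> powr p) < \<delta>"
    using lp_small_tail[OF vmem \<delta>] by blast
  have vK: "(\<Sum>i\<in>{K..<L}. \<bar>v i\<bar> powr p) < \<delta>" for L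
  proof -
    have "(\<Sum>i\<in>{K..<L}. \<bar>v i\<bar> powr p) = (\<Sum>i<L-K. \<bar>v (i + K)\<bar> powr p)"
      by (rule sum.reindex_bij_witness[of _ "\<lambda>i. i + K" "\<lambda>i. i - K"]) auto
    also have "\<dots> \<le> (\<Sum>i. \<bar>v (i + K)\<bar> powr p)"
      using vmem by (intro sum_le_suminf) (auto simp: mem_lp_space summable_iff_shift[of "\<lambda>i. \<bar>v i\<bar> powr p"])
    finally show ?thesis using K by simp
  qed
  have "\<forall>\<^sub>F m in sequentially. \<forall>\<^sub>F n in sequentially. (\<Sum>i<K. \<bar>w m i - w n i\<bar> powr p) < \<delta>"
  proof -
    have ev: "\<forall>\<^sub>F m in sequentially. (\<Sum>i<K. \<bar>w m i - v i\<bar> powr p) < \<delta>"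
    proof (rule order_tendstoD)
      show "(\<lambda>m. \<Sum>i<K. \<bar>w m i - v i\<bar> powr p) \<longlonglongrightarrow> (\<Sum>i<K. \<bar>v i - v i\<bar> powr p)"
        using p by (intro tendsto_sum tendsto_powr' tendsto_rabs tendsto_diff w_lim) auto
    qed (use \<delta> in simp)
    show ?thesis using ev
    proof eventually_elim
      case (elim m)
      show ?case
      proof (rule order_tendstoD)
        show "(\<lambda>n. \<Sum>i<K. \<bar>w m i - w n i\<bar> powr p) \<longlonglongrightarrow> (\<Sum>i<K. \<bar>w m i - v i\<bar> powr p)"
          using p by (intro tendsto_sum tendsto_powr' tendsto_rabs tendsto_diff w_lim) auto
      qed (use elim in simp)
    qed
  qed
  then obtain m where m: "\<forall>\<^sub>F n in sequentially. (\<Sum>i<K. \<bar>w m i - w n i\<bar> powr p) < \<delta>"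
    using eventually_happens sequentially_bot by blast
  obtain L0 where L0: "\<And>L. L \<ge> L0 \<Longrightarrow> (\<Sum>i. \<bar>w m (i + L)\<bar> powr p) < \<delta>"
    using lp_small_tail[OF w(1)[of m] \<delta>] by blast
  obtain L where L: "K \<le> L" "(\<Sum>i. \<bar>w m (i + L)\<bar> powr p) < \<delta>"
    using L0[of "max K L0"] that[of "max K L0"] by simp
  have "\<forall>\<^sub>F n in sequentially. (\<Sum>i\<in>{K..<L}. \<bar>w n i\<bar> powr p) < \<delta>"
    by (rule order_tendstoD(2)[OF lim vK])
  then have "\<forall>\<^sub>F n in sequentially. (\<Sum>i<K. \<bar>w m i - w n i\<bar> powr p) < \<delta>
      \<and> (\<Sum>i\<in>{K..<L}. \<bar>w n i\<bar> powr p) < \<delta> \<and> m < n"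
    using m eventually_gt_at_top[of m] by eventually_elim auto
  then obtain n where n: "(\<Sum>i<K. \<bar>w m i - w n i\<bar> powr p) < \<delta>"
      "(\<Sum>i\<in>{K..<L}. \<bar>w n i\<bar> powr p) < \<delta>" "m < n"
    using eventually_happens sequentially_bot by blast
  \<comment> \<open>\<open>a\<close> consists of the two surviving pieces, \<open>b\<close> of the three small ones, each of mass at most \<open>\<delta>\<close>.\<close>
  define a where "a i = (if i < K then 0 else if i < L then w m i else - w n i)" for i
  define b where "b i = (if i < K then w m i - w n i else if i < L then - w n i else w m i)" for i
  have split: "mass p z = (\<Sum>i<K. \<bar>z i\<bar> powr p) + (\<Sum>i\<in>{K..<L}. \<bar>z i\<bar> powr p)
      + (\<Sum>i. \<bar>z (i + L)\<bar> powr p)" if "z \<in> lp_space p" for z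
  proof -
    have "mass p z = (\<Sum>i. \<bar>z (i + L)\<bar> powr p) + (\<Sum>i<L. \<bar>z i\<bar> powr p)"
      unfolding mass_def using that
      by (intro suminf_split_initial_segment) (simp add: mem_lp_space)
    also have "{..<L} = {..<K} \<union> {K..<L}" using L(1) by auto
    finally show ?thesis by (subst (asm) sum.union_disjoint) auto
  qed
  have mem_tail: "z \<in> lp_space p" if "\<And>i. \<bar>z (i + L)\<bar> = \<bar>y (i + L)\<bar>" "y \<in> lp_space p" for z y
    using that summable_iff_shift[of "\<lambda>i. \<bar>z i\<bar> powr p" L]
      summable_iff_shift[of "\<lambda>i. \<bar>y i\<bar> powr p" L]
    by (simp add: mem_lp_space)
  have a: "a \<in> lp_space p"
    by (rule mem_tail[of _ "w n"]) (use L(1) w in \<open>auto simp: a_def\<close>)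
  have b: "b \<in> lp_space p"
    by (rule mem_tail[of _ "w m"]) (use L(1) w in \<open>auto simp: b_def\<close>)
  have tail_le: "(\<Sum>i. \<bar>w n (i + L)\<bar> powr p) \<le> r powr p"
  proof -
    have "0 \<le> (\<Sum>i<K. \<bar>w n i\<bar> powr p) + (\<Sum>i\<in>{K..<L}. \<bar>w n i\<bar> powr p)"
      by (intro add_nonneg_nonneg sum_nonneg) auto
    then show ?thesis using split[OF w(1)[of n]] w(2)[of n] by linarith
  qed
  have "mass p a = (\<Sum>i\<in>{K..<L}. \<bar>w m i\<bar> powr p) + (\<Sum>i. \<bar>w n (i + L)\<bar> powr p)"
    unfolding split[OF a] using L(1) p by (simp add: a_def)
  also have "\<dots> \<le> 2 * r powr p"
    using tail_le sum_powr_le_mass[OF w(1)[of m], of "{K..<L}"] w(2)[of m] by simp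
  also have "\<dots> = (2 powr (1 / p) * r) powr p"
    using p r by (simp add: powr_mult powr_powr)
  finally have a_le: "mass p a \<le> (2 powr (1 / p) * r) powr p" .
  have "mass p b = (\<Sum>i<K. \<bar>w m i - w n i\<bar> powr p) + (\<Sum>i\<in>{K..<L}. \<bar>w n i\<bar> powr p)
      + (\<Sum>i. \<bar>w m (i + L)\<bar> powr p)"
    unfolding split[OF b] using L(1) by (simp add: b_def)
  also have "\<dots> \<le> 3 * \<delta>" using n L(2) by simp
  finally have b_le: "mass p b \<le> \<epsilon> powr p" by (simp add: \<delta>_def)
  have "(\<lambda>i. w m i - w n i) = (\<lambda>i. a i + b i)"
    by (auto simp: a_def b_def)
  then have "mass p (\<lambda>i. w m i - w n i) \<le> (2 powr (1 / p) * r + \<epsilon>) powr p"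
    using minkowski_mass(2)[OF p _ e a a_le b b_le] r by simp
  then show ?thesis
    using that[of "k m" "k n"] k(1) n(3) by (simp add: w_def strict_mono_less)
qed

text \<open>
  The hypothesis on \<open>r\<close> says \<open>2 powr (1 / p) * r < 1\<close>, so the gap to \<open>1\<close> can serve as the
  \<open>\<epsilon>\<close> of the previous lemma: infinitely many points in the ball would include two at distance
  at most \<open>1\<close>.
\<close>

lemma finite_dispersed_in_ball:
  assumes p: "1 \<le> p" and disp: "dispersed (lp_space p) (lp_norm p) 1 P"
    and r: "0 < r" "2 * r powr p < 1" and x: "x \<in> lp_space p"
  shows "finite {c \<in> P. mass p (\<lambda>i. c i - x i) \<le> r powr p}" (is "finite ?S")
proof (rule ccontr)
  assume "infinite ?S"
  then obtain c :: "nat \<Rightarrow> nat \<Rightarrow> real" where c: "inj c" "range c \<subseteq> ?S"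
    using infinite_countable_subset by blast
  define u where "u n = (\<lambda>i. c n i - x i)" for n
  have cP: "c n \<in> P" for n using c(2) by auto
  have cl: "c n \<in> lp_space p" for n using cP disp by (auto simp: dispersed_def)
  have "2 powr (1 / p) * r = (2 * r powr p) powr (1 / p)"
    using p r(1) by (simp add: powr_mult powr_powr)
  also have "\<dots> < 1 powr (1 / p)"
    using p r by (intro powr_less_mono2) auto
  finally have "0 < 1 - 2 powr (1 / p) * r" by simp
  moreover have "u n \<in> lp_space p" "mass p (u n) \<le> r powr p" for n
    using lp_space_diff[OF p cl x] c(2) by (auto simp: u_def)
  ultimately obtain m n where mn: "m < n"
      "mass p (\<lambda>i. u m i - u n i) \<le> (2 powr (1 / p) * r + (1 - 2 powr (1 / p) * r)) powr p"
    using gliding_hump[OF p r(1), of _ u] by blast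
  have "mass p (\<lambda>i. c m i - c n i) \<le> 1 powr p" using mn(2) by (simp add: u_def)
  then have "lp_norm p (c m - c n) \<le> 1"
    using lp_norm_le_iff_mass[OF p _ lp_space_diff[OF p cl[of m] cl[of n]], of 1]
    by (simp add: fun_diff_def)
  moreover have "c m \<noteq> c n" using c(1) mn(1) by (auto dest: injD)
  ultimately show False
    using disp cP unfolding dispersed_def by (meson linorder_not_le)
qed

section \<open>Improving a covering\<close>

text \<open>
  The radius \<open>\<rho>\<close> only serves to keep all relevant points in a ball to which the finiteness lemma
  applies. It is kept apart from the current bound \<open>B\<close> so that the lemma can be iterated with the
  same \<open>\<rho>\<close> and \<open>t\<close> while \<open>B\<close> decreases by \<open>t powr p\<close> each time.
\<close>

lemma covering_improvement:
  assumes p: "1 \<le> p" and disp: "dispersed (lp_space p) (lp_norm p) 1 P"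
    and t: "0 < t" and \<rho>: "0 < \<rho>" "2 * (\<rho> + t) powr p < 1"
    and B: "B \<le> \<rho> powr p"
    and cov: "\<And>x. x \<in> lp_space p \<Longrightarrow> \<exists>c\<in>P. mass p (\<lambda>i. c i - x i) \<le> B"
    and x: "x \<in> lp_space p"
  shows "\<exists>c\<in>P. mass p (\<lambda>i. c i - x i) \<le> B - t powr p"
proof -
  \<comment> \<open>Lowering \<open>x n\<close> raises the \<open>n\<close>-th coordinate of \<open>c - x\<close> by \<open>t\<close>.\<close>
  have "\<exists>c\<in>P. mass p (\<lambda>i. c i - (x(n := x n - t)) i) \<le> B" for n
    by (intro cov mass_fun_upd(1) x)
  then obtain c where c: "\<And>n. c n \<in> P"
      "\<And>n. mass p (\<lambda>i. c n i - (x(n := x n - t)) i) \<le> B" by metis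
  have cl: "c n \<in> lp_space p" for n using c(1) disp by (auto simp: dispersed_def)
  \<comment> \<open>Undoing the shift costs at most \<open>t\<close>, by the triangle inequality.\<close>
  have near: "mass p (\<lambda>i. c n i - x i) \<le> (\<rho> + t) powr p" for n
  proof -
    have z: "(\<lambda>i. 0::real) \<in> lp_space p" by (simp add: mem_lp_space)
    have "mass p ((\<lambda>i. 0)(n := - t)) = t powr p"
      unfolding mass_fun_upd(2)[OF z] using t by (simp add: mass_def)
    then have "mass p (\<lambda>i. (c n i - (x(n := x n - t)) i) + ((\<lambda>i. 0)(n := - t)) i)
        \<le> (\<rho> + t) powr p"
      using order_trans[OF c(2)[of n] B]
      by (intro minkowski_mass(2) p t \<rho> lp_space_diff cl mass_fun_upd(1) x z) (simp_all only: order_refl)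
    also have "(\<lambda>i. (c n i - (x(n := x n - t)) i) + ((\<lambda>i. 0)(n := - t)) i)
        = (\<lambda>i. c n i - x i)" by auto
    finally show ?thesis .
  qed
  have "finite (range c)"
    by (rule finite_subset[OF _ finite_dispersed_in_ball[OF p disp _ \<rho>(2) x]])
       (use c near \<rho> t in auto)
  then obtain n0 where n0: "infinite {n. c n = c n0}"
    using pigeonhole_infinite[of UNIV c] by auto
  define y where "y = (\<lambda>i. c n0 i - x i)"
  have y: "y \<in> lp_space p" unfolding y_def by (rule lp_space_diff[OF p cl x])
  define f where "f n = mass p y - \<bar>y n\<bar> powr p + \<bar>y n + t\<bar> powr p" for n
  have f_le: "f n \<le> B" if "c n = c n0" for n
  proof -
    have "(\<lambda>i. c n i - (x(n := x n - t)) i) = y(n := y n + t)"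
      using that by (auto simp: y_def)
    then show ?thesis using c(2)[of n] mass_fun_upd(2)[OF y] by (simp add: f_def)
  qed
  have "f \<longlonglongrightarrow> mass p y - \<bar>0\<bar> powr p + \<bar>0 + t\<bar> powr p"
    unfolding f_def using p
    by (intro tendsto_add tendsto_diff tendsto_const tendsto_powr' tendsto_rabs
        lp_space_tendsto_zero[OF p y]) auto
  then have lim: "f \<longlonglongrightarrow> mass p y + t powr p" using t by simp
  have "mass p y + t powr p \<le> B"
  proof (rule ccontr)
    assume "\<not> ?thesis"
    then have "\<forall>\<^sub>F n in sequentially. B < f n" using order_tendstoD(1)[OF lim] by simp
    then have "\<forall>\<^sub>F n in sequentially. c n \<noteq> c n0" by eventually_elim (use f_le in force)
    then show False
      using n0 by (simp add: cofinite_eq_sequentially[symmetric] eventually_cofinite)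
  qed
  then have "mass p (\<lambda>i. c n0 i - x i) \<le> B - t powr p" by (simp add: y_def)
  with c(1) show ?thesis by blast
qed

section \<open>The lower bound for the covering radius\<close>

theorem proposition2:
  fixes p :: real and P :: "(nat \<Rightarrow> real) set"
  assumes "1 \<le> p"
    and "dispersed (lp_space p) (lp_norm p) 1 P"
  shows "covering_radius (lp_space p) (lp_norm p) P \<ge> ereal (2 powr (- (1 / p)))"
  unfolding covering_radius_def
proof (rule Inf_greatest, clarsimp)
  fix R assume cov: "is_covering (lp_space p) (lp_norm p) R P"
  define s :: real where "s = 2 powr (- (1 / p))"
  have "s powr p = 2 powr (- 1)"
    unfolding s_def powr_powr using assms(1) by simp
  then have s: "0 < s" "s powr p = 1 / 2"
    by (simp_all add: s_def powr_minus_divide)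
  have PX: "P \<subseteq> lp_space p" using assms(2) by (simp add: dispersed_def)
  show "2 powr (- (1 / p)) \<le> R"
  proof (rule ccontr)
    assume "\<not> ?thesis"
    then have "R < s" by (simp add: s_def)
    \<comment> \<open>The maximum makes the radius positive, whatever the sign of \<open>R\<close>.\<close>
    define \<rho> where "\<rho> = max R (s / 2)"
    define t where "t = (s - \<rho>) / 2"
    have \<rho>: "0 < \<rho>" "R \<le> \<rho>" "\<rho> < s" using \<open>R < s\<close> s(1) by (auto simp: \<rho>_def)
    then have t: "0 < t" "0 < \<rho> + t" "\<rho> + t < s" by (auto simp: t_def field_simps)
    have "(\<rho> + t) powr p < s powr p" using t assms(1) by (intro powr_less_mono2) auto
    then have small: "2 * (\<rho> + t) powr p < 1" using s(2) by simp
    have base: "\<exists>c\<in>P. mass p (\<lambda>i. c i - x i) \<le> \<rho> powr p" if x: "x \<in> lp_space p" for x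
    proof -
      obtain c where c: "c \<in> P" "lp_norm p (c - x) \<le> R"
        using cov x unfolding is_covering_def closed_ball_def by blast
      have "lp_norm p (\<lambda>i. c i - x i) \<le> \<rho>" using c(2) \<rho>(2) by (simp add: fun_diff_def)
      then show ?thesis
        using lp_norm_le_iff_mass[OF assms(1) _ lp_space_diff[OF assms(1) _ x]] c(1) PX \<rho>(1)
        by (metis less_imp_le subsetD)
    qed
    have iter: "\<forall>x\<in>lp_space p. \<exists>c\<in>P. mass p (\<lambda>i. c i - x i) \<le> \<rho> powr p - real k * t powr p" for k
    proof (induction k)
      case 0
      then show ?case using base by simp
    next
      case (Suc k)
      show ?case
      proof
        fix x assume "x \<in> lp_space p"
        then have "\<exists>c\<in>P. mass p (\<lambda>i. c i - x i) \<le> (\<rho> powr p - real k * t powr p) - t powr p"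
          using Suc.IH
          by (intro covering_improvement[OF assms t(1) \<rho>(1) small]) auto
        then show "\<exists>c\<in>P. mass p (\<lambda>i. c i - x i) \<le> \<rho> powr p - real (Suc k) * t powr p"
          by (simp add: algebra_simps)
      qed
    qed
    obtain k :: nat where k: "\<rho> powr p < real k * t powr p"
      using reals_Archimedean3[of "t powr p"] t(1) by auto
    have z: "(\<lambda>i. 0) \<in> lp_space p" by (simp add: mem_lp_space)
    obtain c where "c \<in> P" "mass p (\<lambda>i. c i - 0) \<le> \<rho> powr p - real k * t powr p"
      using bspec[OF iter[of k] z] by (elim bexE)
    moreover have "0 \<le> mass p c" using \<open>c \<in> P\<close> PX by (intro mass_nonneg) blast
    ultimately show False using k by simp
  qed
qed

end
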